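(* Let $G$ be a connected graph on $n$ vertices, where $n$ is even. Then $G$ has a perfect forest.
   Context: Graphs are finite, simple and undirected. A spanning subgraph $F$ of a graph $G$ (that is, a subgraph with $V(F)=V(G)$) is called a perfect forest of $G$ if: (i) $F$ is a forest (it contains no cycles); (ii) the degree in $F$ of every vertex is odd; and (iii) each connected component (tree) of $F$ is an induced subgraph of $G$, i.e. for every component $H$ of $F$, any two vertices of $H$ that are adjacent in $G$ are also adjacent in $H$. *)

theory Defs
  imports "Graph_Theory.Graph_Theory"
begin

text \<open>
  A finite simple undirected graph is a digraph satisfying the locale predicate \<^const>\<open>Digraph.graph\<close>:
  finite, loop-free, without parallel arcs and symmetric, so that an undirected edge is a pair of
  opposite arcs. The degree of a vertex is therefore its \<^const>\<open>out_degree\<close>.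
\<close>

text \<open>
  The walk \<open>u, v, u\<close> along the two arcs of a single edge is a directed cycle, but not a cycle of
  the undirected graph. Hence the bound on the length, and hence the library's
  \<^const>\<open>Digraph_Component.forest\<close>, which holds for a symmetric digraph only if it has no arcs, is not used.
\<close>

definition undirected_cycle :: "('a, 'b) pre_digraph \<Rightarrow> 'b awalk \<Rightarrow> bool" where
  "undirected_cycle G p \<longleftrightarrow> pre_digraph.cycle G p \<and> 3 \<le> length p"

definition undirected_forest :: "('a, 'b) pre_digraph \<Rightarrow> bool" where
  "undirected_forest G \<longleftrightarrow> Digraph.graph G \<and> \<not> (\<exists>p. undirected_cycle G p)"

definition connected_component_of ::
    "('a, 'b) pre_digraph \<Rightarrow> ('a, 'b) pre_digraph \<Rightarrow> bool" where
  "connected_component_of H G \<longleftrightarrow> pre_digraph.max_subgraph G Digraph_Component.connected H"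

definition perfect_forest :: "('a, 'b) pre_digraph \<Rightarrow> ('a, 'b) pre_digraph \<Rightarrow> bool" where
  "perfect_forest F G \<longleftrightarrow>
     spanning F G \<and>
     undirected_forest F \<and>
     (\<forall>v \<in> verts F. odd (out_degree F v)) \<and>
     (\<forall>H. connected_component_of H F \<longrightarrow> induced_subgraph H G)"

end

theory Submission
  imports Defs
begin

text \<open>
  Among all spanning subgraphs of \<open>G\<close> in which every vertex has odd degree, one with the fewest
  edges is a perfect forest.

  Such subgraphs exist: the edge set of a path has odd degree exactly at the two ends of the path,
  and degree parities add up under symmetric difference. So, pairing up the vertices of \<open>G\<close> and
  adding a path between the two vertices of each pair gives every vertex odd degree
  (\<open>odd_edge_set_exists\<close>).

  Minimality is used in one way only (\<open>min_odd_no_detour\<close>). Suppose that an edge \<open>uv\<close> of \<open>G\<close>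
  has its ends joined by a path \<open>P\<close> of the minimal subgraph \<open>F\<close> with at least two edges. The cycle
  formed by \<open>P\<close> and \<open>uv\<close> has even degrees, so taking the symmetric difference of \<open>F\<close> with it keeps
  all degrees odd; this removes the edges of \<open>P\<close> and adds at most \<open>uv\<close>, so the result has fewer
  edges, a contradiction. If \<open>uv\<close> is itself an edge of \<open>F\<close>, this says that \<open>F\<close> has no cycle.
  If \<open>u\<close> and \<open>v\<close> lie in the same component of \<open>F\<close>, it says that the path of \<open>F\<close> between them is
  the edge \<open>uv\<close>, so that the component is induced.
\<close>

section \<open>Edge sets and degree parities\<close>

text \<open>
  Undirected edges are two-element sets of vertices, so that the two opposite arcs of an edge are
  removed or added together and the symmetric difference of edge sets is again one.
\<close>

definition edge_of :: "('a, 'b) pre_digraph \<Rightarrow> 'b \<Rightarrow> 'a set" where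
  "edge_of G a = {tail G a, head G a}"

definition odd_at :: "'a set set \<Rightarrow> 'a \<Rightarrow> bool" where
  "odd_at A v \<longleftrightarrow> odd (card {e \<in> A. v \<in> e})"

definition spanned_by :: "('a, 'b) pre_digraph \<Rightarrow> 'a set set \<Rightarrow> ('a, 'b) pre_digraph" where
  "spanned_by G A = G\<lparr>arcs := {a \<in> arcs G. edge_of G a \<in> A}\<rparr>"

lemma spanned_by_simps [simp]:
  "verts (spanned_by G A) = verts G" "tail (spanned_by G A) = tail G"
  "head (spanned_by G A) = head G" "arcs (spanned_by G A) = {a \<in> arcs G. edge_of G a \<in> A}"
  by (auto simp: spanned_by_def)

lemma edge_of_spanned_by [simp]: "edge_of (spanned_by G A) = edge_of G"
  by (auto simp: edge_of_def)

lemma odd_card_sym_diff: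
  assumes "finite A" "finite B"
  shows "odd (card (sym_diff A B)) \<longleftrightarrow> odd (card A) \<noteq> odd (card B)"
proof -
  have "card (sym_diff A B) = card (A - B) + card (B - A)"
    using assms by (intro card_Un_disjoint) auto
  moreover have "card A = card (A - B) + card (A \<inter> B)"
    using assms by (subst card_Un_disjoint [symmetric]) (auto intro: arg_cong [where f = card])
  moreover have "card B = card (B - A) + card (A \<inter> B)"
    using assms by (subst card_Un_disjoint [symmetric]) (auto intro: arg_cong [where f = card])
  ultimately show ?thesis by (simp only: even_add) blast
qed

lemma odd_at_sym_diff:
  assumes "finite A" "finite B"
  shows "odd_at (sym_diff A B) v \<longleftrightarrow> odd_at A v \<noteq> odd_at B v"
proof -
  have "{e \<in> sym_diff A B. v \<in> e} = sym_diff {e \<in> A. v \<in> e} {e \<in> B. v \<in> e}"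
    by auto
  then show ?thesis
    using assms by (simp only: odd_at_def) (rule odd_card_sym_diff, auto)
qed

lemma odd_at_empty [simp]: "\<not> odd_at {} v"
  by (simp add: odd_at_def)

lemma odd_at_singleton [simp]: "odd_at {e} v \<longleftrightarrow> v \<in> e"
proof -
  have "{e' \<in> {e}. v \<in> e'} = (if v \<in> e then {e} else {})" by auto
  then show ?thesis by (simp add: odd_at_def)
qed

context wf_digraph
begin

text \<open>A path does not return to its first vertex, with which its first edge is incident.\<close>

lemma first_edge_of_apath_fresh:
  assumes "apath u (a # p) v"
  shows "edge_of G a \<notin> edge_of G ` set p"
proof
  assume "edge_of G a \<in> edge_of G ` set p"
  then obtain b where b: "b \<in> set p" "edge_of G a = edge_of G b" by auto
  have "awalk (head G a) p v" and "u \<notin> set (awalk_verts (head G a) p)" "u = tail G a"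
    using assms by (auto simp: apath_Cons_iff dest: awalkI_apath)
  with b have "u \<notin> edge_of G b"
    by (auto simp: edge_of_def dest: awalk_verts_arc1 awalk_verts_arc2)
  with b \<open>u = tail G a\<close> show False by (auto simp: edge_of_def)
qed

lemma card_edges_apath:
  "apath u p v \<Longrightarrow> card (edge_of G ` set p) = length p"
proof (induction p arbitrary: u)
  case (Cons a p)
  then show ?case
    using first_edge_of_apath_fresh [OF Cons.prems] by (auto simp: apath_Cons_iff card_insert_if)
qed simp

lemma odd_at_apath:
  "apath u p v \<Longrightarrow> odd_at (edge_of G ` set p) x \<longleftrightarrow> (x = u) \<noteq> (x = v)"
proof (induction p arbitrary: u)
  case Nil
  then show ?case by (simp add: apath_Nil_iff)
next
  case (Cons a p)
  have p: "apath (head G a) p v" and u: "u = tail G a"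
    and ne: "tail G a \<notin> set (awalk_verts (head G a) p)"
    using Cons.prems by (auto simp: apath_Cons_iff)
  have "head G a \<noteq> tail G a"
    using ne hd_in_awalk_verts(2) [OF p] by auto
  have "edge_of G ` set (a # p) = sym_diff {edge_of G a} (edge_of G ` set p)"
    using first_edge_of_apath_fresh [OF Cons.prems] by auto
  then have "odd_at (edge_of G ` set (a # p)) x \<longleftrightarrow>
      (x \<in> edge_of G a) \<noteq> ((x = head G a) \<noteq> (x = v))"
    using Cons.IH [OF p] by (simp only: odd_at_sym_diff finite.intros finite_imageI finite_set
        odd_at_singleton)
  then show ?case
    using \<open>head G a \<noteq> tail G a\<close> u by (auto simp: edge_of_def)
qed

end

section \<open>Odd edge sets exist\<close>

text \<open>
  By induction on \<open>T\<close>: a path between two vertices of \<open>T\<close> toggles the parity at exactly these two,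
  even if it shares edges with the set found for the other vertices. Stating the result for
  every \<open>T\<close> of even size, and not only for the vertex set, is what makes the induction work.
\<close>

lemma (in fin_digraph) odd_edge_set_exists:
  assumes "strongly_connected G" and "T \<subseteq> verts G" and "even (card T)"
  shows "\<exists>A \<subseteq> edge_of G ` arcs G. \<forall>x. odd_at A x \<longleftrightarrow> x \<in> T"
  using assms(2,3)
proof (induction "card T" arbitrary: T rule: less_induct)
  case less
  have "finite T" by (rule finite_subset [OF less.prems(1)]) simp
  show ?case
  proof (cases "T = {}")
    case True
    then show ?thesis by (intro exI [of _ "{}"]) auto
  next
    case False
    then obtain u where u: "u \<in> T" by auto
    have "T \<noteq> {u}" using less.prems by auto
    with u obtain w where w: "w \<in> T" "w \<noteq> u" by auto
    have "card {u, w} \<le> card T"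
      using u w \<open>finite T\<close> by (intro card_mono) auto
    moreover have "card (T - {u, w}) = card T - card {u, w}"
      using u w by (intro card_Diff_subset) auto
    ultimately have "card (T - {u, w}) < card T" "even (card (T - {u, w}))"
      using w less.prems by auto
    moreover have "T - {u, w} \<subseteq> verts G" using less.prems by auto
    ultimately obtain A
      where A: "A \<subseteq> edge_of G ` arcs G" "\<And>x. odd_at A x \<longleftrightarrow> x \<in> T - {u, w}"
      using less.hyps [of "T - {u, w}"] by blast
    have "u \<rightarrow>\<^sup>* w"
      using assms(1) u w less.prems by (auto simp: strongly_connected_def)
    then obtain p where p: "apath u p w" by (auto simp: reachable_apath)
    let ?P = "edge_of G ` set p"
    have P: "?P \<subseteq> edge_of G ` arcs G" using p by (auto simp: apath_def)
    have "finite A" by (rule finite_subset [OF A(1)]) simp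
    have "odd_at (sym_diff A ?P) x \<longleftrightarrow> x \<in> T" for x
      using odd_at_sym_diff [OF \<open>finite A\<close>, of ?P x] A(2) [of x] odd_at_apath [OF p, of x] u w
      by auto
    moreover have "sym_diff A ?P \<subseteq> edge_of G ` arcs G" using A P by auto
    ultimately show ?thesis by blast
  qed
qed

section \<open>Subgraphs spanned by edge sets\<close>

context graph
begin

lemma edge_of_eq_cases:
  assumes "a \<in> arcs G" "b \<in> arcs G" "edge_of G a = edge_of G b"
  shows "a = b \<or> tail G a = head G b \<and> head G a = tail G b"
  using assms no_multi_arcs [of a b] by (auto simp: edge_of_def arc_to_ends_def doubleton_eq_iff)

lemma opposite_arc:
  assumes "a \<in> arcs G"
  obtains b where "b \<in> arcs G" "tail G b = head G a" "head G b = tail G a"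
    "edge_of G b = edge_of G a"
proof -
  obtain b where "b \<in> arcs G" "tail G a = head G b" "head G a = tail G b"
    using assms sym_arcs unfolding symmetric_conv by blast
  then show thesis by (intro that [of b]) (auto simp: edge_of_def)
qed

lemma subgraph_spanned_by: "subgraph (spanned_by G A) G"
  by (rule subgraphI) (unfold_locales, auto simp: compatible_def)

lemma graph_spanned_by: "Digraph.graph (spanned_by G A)"
proof -
  interpret F: digraph "spanned_by G A" by (rule digraph_subgraph [OF subgraph_spanned_by])
  have "symmetric (spanned_by G A)"
    unfolding symmetric_conv by (auto, metis opposite_arc)
  then show ?thesis ..
qed

text \<open>Of the two opposite arcs of an edge at \<open>v\<close>, exactly one leaves \<open>v\<close>.\<close>

lemma out_degree_spanned_by:
  assumes "A \<subseteq> edge_of G ` arcs G"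
  shows "out_degree (spanned_by G A) v = card {e \<in> A. v \<in> e}"
proof -
  have "bij_betw (edge_of G) (out_arcs (spanned_by G A) v) {e \<in> A. v \<in> e}"
  proof (rule bij_betw_imageI)
    show "inj_on (edge_of G) (out_arcs (spanned_by G A) v)"
    proof (rule inj_onI)
      fix a b
      assume ab: "a \<in> out_arcs (spanned_by G A) v" "b \<in> out_arcs (spanned_by G A) v"
        and eq: "edge_of G a = edge_of G b"
      then have "a \<in> arcs G" "b \<in> arcs G" "tail G a = tail G b" by auto
      then show "a = b" using edge_of_eq_cases [OF _ _ eq] no_loops [of b] by auto
    qed
    have "e \<in> edge_of G ` out_arcs (spanned_by G A) v" if e: "e \<in> A" "v \<in> e" for e
    proof -
      from e assms obtain a where a: "a \<in> arcs G" "e = edge_of G a" by auto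
      then obtain b where b: "b \<in> arcs G" "tail G b = head G a" "edge_of G b = edge_of G a"
        by (metis opposite_arc)
      have "v = tail G a \<or> v = tail G b" using a b e by (auto simp: edge_of_def)
      then show ?thesis using a b e by (auto intro: rev_image_eqI)
    qed
    then show "edge_of G ` out_arcs (spanned_by G A) v = {e \<in> A. v \<in> e}"
      by (auto simp: edge_of_def)
  qed
  then show ?thesis unfolding out_degree_def by (rule bij_betw_same_card)
qed

end

lemma arc_mono_connected: "arc_mono Digraph_Component.connected"
  unfolding arc_mono_def
proof (intro allI impI, elim conjE)
  fix H1 H2 :: "('a, 'b) pre_digraph"
  assume conn: "Digraph_Component.connected H1"
    and sub: "subgraph H1 H2" and eq: "verts H1 = verts H2"
  interpret wf_digraph H2 using sub by (rule subgraphE)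
  have "spanning H1 H2" using sub eq by (simp add: spanning_def)
  then show "Digraph_Component.connected H2"
    using conn by (rule connected_spanning_imp_connected)
qed

section \<open>Minimal odd edge sets\<close>

definition odd_edge_set :: "('a, 'b) pre_digraph \<Rightarrow> 'a set set \<Rightarrow> bool" where
  "odd_edge_set G A \<longleftrightarrow> A \<subseteq> edge_of G ` arcs G \<and> (\<forall>v \<in> verts G. odd_at A v)"

locale min_odd_edge_set = graph +
  fixes A :: "'a set set"
  assumes odd_edge_set: "odd_edge_set G A"
    and minimal: "odd_edge_set G B \<Longrightarrow> card A \<le> card B"
begin

abbreviation F :: "('a, 'b) pre_digraph" where
  "F \<equiv> spanned_by G A"

sublocale F: graph F
  by (rule graph_spanned_by)

text \<open>
  Otherwise delete the path from \<open>A\<close> and toggle the edge of \<open>a\<close>. Both steps change the parity at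
  exactly the two ends, and the first one loses more edges than the second one can add.
\<close>

lemma min_odd_no_detour:
  assumes "a \<in> arcs G" and p: "F.apath (head G a) p (tail G a)"
  shows "length p \<le> 1"
proof (rule ccontr)
  assume long: "\<not> length p \<le> 1"
  define P where "P = edge_of G ` set p"
  have A: "A \<subseteq> edge_of G ` arcs G" "\<And>v. v \<in> verts G \<Longrightarrow> odd_at A v"
    using odd_edge_set by (auto simp: odd_edge_set_def)
  have fin: "finite A" "finite P"
    using finite_subset [OF A(1)] by (simp_all add: P_def)
  have "P \<subseteq> A" using p by (auto simp: P_def F.apath_def F.awalk_def)
  then have PA: "sym_diff A P = A - P" by auto
  let ?B = "sym_diff (A - P) {edge_of G a}"
  have "odd_at ?B v \<longleftrightarrow> odd_at A v" for v
  proof -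
    have "odd_at P v \<longleftrightarrow> (v = head G a) \<noteq> (v = tail G a)"
      using F.odd_at_apath [OF p] by (simp add: P_def)
    also have "\<dots> \<longleftrightarrow> v \<in> edge_of G a"
      using no_loops [OF assms(1)] by (auto simp: edge_of_def)
    finally show ?thesis
      using odd_at_sym_diff [OF fin, of v] odd_at_sym_diff [of "A - P" "{edge_of G a}" v] fin PA
      by simp blast
  qed
  then have "odd_edge_set G ?B"
    using A assms(1) by (auto simp: odd_edge_set_def)
  then have "card A \<le> card ?B" by (rule minimal)
  also have "card ?B \<le> card (insert (edge_of G a) (A - P))"
    using fin by (intro card_mono) auto
  also have "\<dots> \<le> Suc (card (A - P))"
    using fin by (simp add: card_insert_if)
  also have "card (A - P) = card A - length p"
    using F.card_edges_apath [OF p] card_Diff_subset [OF fin(2) \<open>P \<subseteq> A\<close>] by (simp add: P_def)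
  finally have "card A \<le> Suc (card A - length p)" .
  moreover have "length p \<le> card A"
    using F.card_edges_apath [OF p] card_mono [OF fin(1) \<open>P \<subseteq> A\<close>] by (simp add: P_def)
  ultimately show False using long by linarith
qed

lemma min_odd_undirected_forest: "undirected_forest F"
proof -
  have False if cyc: "F.cycle q" and long: "3 \<le> length q" for q
  proof -
    obtain u where u: "F.awalk u q u" "distinct (tl (F.awalk_verts u q))"
      using cyc by (auto simp: F.cycle_def)
    obtain a p where q: "q = a # p" using long by (cases q) auto
    have "a \<in> arcs G" "F.apath (head G a) p (tail G a)"
      using u by (auto simp: q F.apath_def F.awalk_Cons_iff)
    then have "length p \<le> 1" by (rule min_odd_no_detour)
    then show False using long by (simp add: q)
  qed
  then show ?thesis
    using F.graph_axioms by (auto simp: undirected_forest_def undirected_cycle_def)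
qed

text \<open>
  A component of \<open>F\<close> contains all arcs of \<open>F\<close> between its vertices, being maximal. An arc of \<open>G\<close>
  between two of its vertices comes with a path of \<open>F\<close> between its ends; this path is a single
  arc with the same edge, so that the given arc belongs to \<open>F\<close> as well.
\<close>

lemma min_odd_component_induced:
  assumes "connected_component_of H F"
  shows "induced_subgraph H G"
proof -
  have max: "F.max_subgraph Digraph_Component.connected H"
    using assms by (simp add: connected_component_of_def)
  then have ind: "induced_subgraph H F"
    using arc_mono_connected by (rule F.induced_subgraphI_arc_mono)
  then have sub: "subgraph H F" by (rule induced_imp_subgraph)
  have "symmetric H" using F.sym_arcs ind by (rule induced_graph_imp_symmetric)
  moreover have "Digraph_Component.connected H" using max by (rule F.max_subgraph_prop)
  ultimately have sc: "strongly_connected H"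
    using sub by (auto intro: wf_digraph.symmetric_connected_imp_strongly_connected)
  have "a \<in> arcs F" if a: "a \<in> arcs G" "tail G a \<in> verts H" "head G a \<in> verts H" for a
  proof -
    have "head G a \<rightarrow>\<^sup>*\<^bsub>H\<^esub> tail G a" using sc a by (auto simp: strongly_connected_def)
    then have "head G a \<rightarrow>\<^sup>*\<^bsub>F\<^esub> tail G a" using sub by (rule F.reachable_mono)
    then obtain p where p: "F.apath (head G a) p (tail G a)" by (auto simp: F.reachable_apath)
    with a(1) have "length p \<le> 1" by (rule min_odd_no_detour)
    moreover have "p \<noteq> []" using p no_loops [OF a(1)] by (auto simp: F.apath_Nil_iff)
    ultimately obtain b where "p = [b]" by (cases p) auto
    with p have "b \<in> arcs F" "edge_of G a = edge_of G b"
      by (auto simp: F.apath_simps edge_of_def)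
    then show ?thesis using a(1) by simp
  qed
  moreover have "arcs H = {a \<in> arcs F. tail G a \<in> verts H \<and> head G a \<in> verts H}"
    using ind by (simp add: induced_subgraph_def)
  ultimately have "arcs H = {a \<in> arcs G. tail G a \<in> verts H \<and> head G a \<in> verts H}"
    by auto
  then show ?thesis
    using subgraph_trans [OF sub subgraph_spanned_by] by (intro induced_subgraphI)
qed

lemma min_odd_perfect_forest: "perfect_forest F G"
proof -
  have "odd (out_degree F v)" if "v \<in> verts F" for v
    using odd_edge_set that by (simp add: odd_edge_set_def odd_at_def out_degree_spanned_by)
  then show ?thesis
    using min_odd_undirected_forest min_odd_component_induced subgraph_spanned_by
    by (simp add: perfect_forest_def spanning_def)
qed

end

theorem theorem2p2:
  fixes G :: "('a, 'b) pre_digraph" and n :: nat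
  assumes "Digraph.graph G"
    and "Digraph_Component.connected G"
    and "card (verts G) = n"
    and "even n"
  shows "\<exists>F. perfect_forest F G"
proof -
  interpret graph G by fact
  have "strongly_connected G"
    using sym_arcs assms(2) by (rule symmetric_connected_imp_strongly_connected)
  then have "\<exists>A. odd_edge_set G A"
    using odd_edge_set_exists [of "verts G"] assms(3,4) by (auto simp: odd_edge_set_def)
  then obtain A where "odd_edge_set G A" "\<And>B. odd_edge_set G B \<Longrightarrow> card A \<le> card B"
    by (metis ex_has_least_nat)
  then interpret min_odd_edge_set G A by unfold_locales
  show ?thesis using min_odd_perfect_forest by blast
qed

end
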